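(* Let $\Gamma$ be a countable set, let $M$ be a measurable space, and let $\underline{X}=(X_k)_{k\in\Gamma}$ be a family of random variables with values in $M$ that has the Kolmogorov mixing property. Let $E\subseteq M^\Gamma$ be an event, and suppose that for every finite set $J\subseteq\Gamma$, the event $E$ has a positional symmetry $\pi\colon\Gamma\to\Gamma$ such that $\pi(J)\cap J=\varnothing$ and such that $\underline{X}$ and $\underline{X}^\pi=(X_{\pi(k)})_{k\in\Gamma}$ have the same distribution. Then $\mathbb{P}(\underline{X}\in E)\in\{0,1\}$.
   Context: $M^\Gamma$ carries the product $\sigma$-algebra, and an event $E\subseteq M^\Gamma$ is a measurable subset. A positional symmetry of an event $E\subseteq M^\Gamma$ is a map $\pi\colon\Gamma\to\Gamma$ (not required to be injective or surjective) such that for every $\underline{a}=(a_k)_{k\in\Gamma}\in M^\Gamma$, one has $\underline{a}\in E$ if and only if $\underline{a}^\pi:=(a_{\pi(k)})_{k\in\Gamma}\in E$. An event $V\subseteq M^\Gamma$ is a cylinder event if it is measurably determined by the coordinates inside a finite set $J\subseteq\Gamma$, i.e. $V=\{\underline{a}\in M^\Gamma:(a_k)_{k\in J}\in V_0\}$ for some measurable $V_0\subseteq M^J$. The family $\underline{X}$ has the Kolmogorov mixing property if for every cylinder event $V\subseteq M^\Gamma$ and every $\varepsilon>0$, there exists a finite set $K\subseteq\Gamma$ such that $$\sup_W\big|\mathbb{P}(\underline{X}\in V\cap W)-\mathbb{P}(\underline{X}\in V)\,\mathbb{P}(\underline{X}\in W)\big|<\varepsilon,$$ where the supremum is over all sets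 $W\subseteq M^\Gamma$ that are measurably determined by the coordinates outside $K$, i.e. $W=\{\underline{a}\in M^\Gamma:(a_k)_{k\in\Gamma\setminus K}\in W_0\}$ for some measurable $W_0\subseteq M^{\Gamma\setminus K}$. *)

theory Defs
  imports "HOL-Probability.Probability"
begin

text \<open>
  The product space is \<open>PiM \<Gamma> (\<lambda>_. M)\<close>, whose points are the functions on \<open>\<Gamma>\<close> with values in
  \<open>space M\<close>, extended by \<open>undefined\<close> outside \<open>\<Gamma>\<close>. The reindexings below are therefore
  restricted to \<open>\<Gamma>\<close>. Only the measurable space underlying \<open>M\<close> is used.
\<close>

abbreviation power_space :: "'i set \<Rightarrow> 'a measure \<Rightarrow> ('i \<Rightarrow> 'a) measure" where
  "power_space \<Gamma> M \<equiv> PiM \<Gamma> (\<lambda>_. M)"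

definition reindex :: "'i set \<Rightarrow> ('i \<Rightarrow> 'i) \<Rightarrow> ('i \<Rightarrow> 'a) \<Rightarrow> ('i \<Rightarrow> 'a)" where
  "reindex \<Gamma> \<pi> a = (\<lambda>k\<in>\<Gamma>. a (\<pi> k))"

definition positional_symmetry ::
    "'i set \<Rightarrow> 'a measure \<Rightarrow> ('i \<Rightarrow> 'a) set \<Rightarrow> ('i \<Rightarrow> 'i) \<Rightarrow> bool" where
  "positional_symmetry \<Gamma> M E \<pi> \<longleftrightarrow>
     \<pi> \<in> \<Gamma> \<rightarrow> \<Gamma> \<and> (\<forall>a\<in>space (power_space \<Gamma> M). a \<in> E \<longleftrightarrow> reindex \<Gamma> \<pi> a \<in> E)"

definition determined_by ::
    "'i set \<Rightarrow> 'a measure \<Rightarrow> 'i set \<Rightarrow> ('i \<Rightarrow> 'a) set \<Rightarrow> bool" where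
  "determined_by \<Gamma> M J V \<longleftrightarrow>
     (\<exists>V0\<in>sets (power_space J M). V = {a \<in> space (power_space \<Gamma> M). restrict a J \<in> V0})"

definition cylinder_event :: "'i set \<Rightarrow> 'a measure \<Rightarrow> ('i \<Rightarrow> 'a) set \<Rightarrow> bool" where
  "cylinder_event \<Gamma> M V \<longleftrightarrow> (\<exists>J. finite J \<and> J \<subseteq> \<Gamma> \<and> determined_by \<Gamma> M J V)"

definition joint :: "'i set \<Rightarrow> ('i \<Rightarrow> 'w \<Rightarrow> 'a) \<Rightarrow> 'w \<Rightarrow> ('i \<Rightarrow> 'a)" where
  "joint \<Gamma> X \<omega> = (\<lambda>k\<in>\<Gamma>. X k \<omega>)"

definition mixing_defect ::
    "'w measure \<Rightarrow> ('w \<Rightarrow> 'b) \<Rightarrow> 'b set \<Rightarrow> 'b set \<Rightarrow> real" where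
  "mixing_defect P Y V W =
     \<bar>\<P>(\<omega> in P. Y \<omega> \<in> V \<inter> W) - \<P>(\<omega> in P. Y \<omega> \<in> V) * \<P>(\<omega> in P. Y \<omega> \<in> W)\<bar>"

text \<open>
  The supremum is taken in the reals; it is meaningful because the index set is nonempty
  and the defect is bounded, as shown by the two lemmas after the definition.
\<close>

definition kolmogorov_mixing ::
    "'w measure \<Rightarrow> 'i set \<Rightarrow> 'a measure \<Rightarrow> ('i \<Rightarrow> 'w \<Rightarrow> 'a) \<Rightarrow> bool" where
  "kolmogorov_mixing P \<Gamma> M X \<longleftrightarrow>
     (\<forall>V \<epsilon>. cylinder_event \<Gamma> M V \<longrightarrow> 0 < \<epsilon> \<longrightarrow>
        (\<exists>K. finite K \<and> K \<subseteq> \<Gamma> \<and>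
           (SUP W\<in>{W. determined_by \<Gamma> M (\<Gamma> - K) W}. mixing_defect P (joint \<Gamma> X) V W) < \<epsilon>))"

lemma determined_by_empty: "determined_by \<Gamma> M J {}"
  unfolding determined_by_def by (rule bexI[of _ "{}"]) auto

lemma (in prob_space) bdd_above_mixing_defect: "bdd_above (mixing_defect M Y V ` \<W>)"
proof (rule bdd_aboveI2)
  fix W assume "W \<in> \<W>"
  let ?p = "prob {\<omega> \<in> space M. Y \<omega> \<in> V \<inter> W}"
  let ?q = "prob {\<omega> \<in> space M. Y \<omega> \<in> V} * prob {\<omega> \<in> space M. Y \<omega> \<in> W}"
  have "0 \<le> ?p" "?p \<le> 1" "0 \<le> ?q" "?q \<le> 1"
    by (auto intro: mult_le_one)
  then show "mixing_defect M Y V W \<le> 1"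
    unfolding mixing_defect_def by linarith
qed

end

theory Submission
  imports Defs
begin

text \<open>
  Approximate \<open>E\<close> by a cylinder event \<open>V\<close> over a finite set \<open>J\<close>, and let mixing for \<open>V\<close> supply the
  finite set \<open>K\<close>. A positional symmetry \<open>\<pi>\<close> displacing \<open>J \<union> K\<close> moves \<open>V\<close> to an event \<open>W\<close>
  determined outside \<open>K\<close>, so \<open>V\<close> and \<open>W\<close> are almost independent. Since \<open>\<pi>\<close> preserves both \<open>E\<close> and
  the distribution, \<open>W\<close> has the probability of \<open>V\<close> and approximates \<open>E\<close> as well as \<open>V\<close> does. Hence
  \<open>E\<close> is almost independent of itself.
\<close>

text \<open>Induction over the generated sigma-algebra. Complementing both sets leaves the symmetric
  difference unchanged. A countable union is truncated to finitely many sets, each approximated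
  separately, and half of \<open>e\<close> is spent on the truncation.\<close>

lemma (in finite_measure) algebra_approximation:
  assumes alg: "algebra (space M) A"
    and gen: "sets M = sigma_sets (space M) A"
    and "E \<in> sets M" and "0 < e"
  shows "\<exists>V\<in>A. measure M (sym_diff E V) < e"
proof -
  interpret A: algebra "space M" A by fact
  have A_sets: "V \<in> sets M" if "V \<in> A" for V
    using that by (simp add: gen sigma_sets.Basic)
  have "E \<in> sigma_sets (space M) A"
    using \<open>E \<in> sets M\<close> gen by simp
  then show ?thesis
    using \<open>0 < e\<close>
  proof (induction arbitrary: e)
    case (Basic a)
    then show ?case by (intro bexI[of _ a]) auto
  next
    case Empty
    then show ?case by (intro bexI[of _ "{}"]) auto
  next
    case (Compl a)
    then obtain V where V: "V \<in> A" "measure M (sym_diff a V) < e" by blast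
    have "a \<subseteq> space M"
      using Compl.hyps sets.sets_into_space gen by blast
    then have "sym_diff (space M - a) (space M - V) = sym_diff a V"
      using A.space_closed V(1) by blast
    then show ?case using V by (intro bexI[of _ "space M - V"]) auto
  next
    case (Union B)
    have B: "B i \<in> sets M" for i using Union.hyps gen by simp
    \<comment> \<open>\<open>C n\<close> is what the first \<open>n\<close> sets miss. These
      remainders decrease to the empty set, so continuity from above makes their measure tend to 0,
      without any disjointness of the \<open>B i\<close>.\<close>
    define C where "C n = (\<Union>i. B i) - (\<Union>i<n. B i)" for n :: nat
    have C: "C n \<in> sets M" for n unfolding C_def using B by auto
    have "(\<lambda>n. measure M (C n)) \<longlonglongrightarrow> measure M (\<Inter>n. C n)"
      by (rule finite_Lim_measure_decseq) (use C in \<open>auto simp: decseq_def C_def\<close>)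
    moreover have "(\<Inter>n. C n) = {}" by (auto simp: C_def)
    ultimately have "(\<lambda>n. measure M (C n)) \<longlonglongrightarrow> 0" by simp
    then have "eventually (\<lambda>n. measure M (C n) < e / 2) sequentially"
      using \<open>0 < e\<close> by (intro order_tendstoD) auto
    then obtain n where n: "measure M (C n) < e / 2"
      by (auto simp: eventually_sequentially)
    \<comment> \<open>The \<open>n\<close> approximation errors then total at most
      \<open>e / 2\<close>. The \<open>+ 1\<close> keeps \<open>d\<close> positive when
      \<open>n = 0\<close>.\<close>
    define d where "d = e / (2 * (real n + 1))"
    have "0 < d" using \<open>0 < e\<close> by (simp add: d_def)
    then have "\<forall>i. \<exists>V\<in>A. measure M (sym_diff (B i) V) < d" using Union.IH by blast
    then obtain V where V: "V i \<in> A" "measure M (sym_diff (B i) (V i)) < d" for i by metis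
    let ?U = "\<Union>i<n. V i"
    have "?U \<in> A" using V(1) by auto
    have "measure M (sym_diff (\<Union>i. B i) ?U)
        \<le> measure M (C n \<union> (\<Union>i<n. sym_diff (B i) (V i)))"
      by (rule finite_measure_mono) (use B C V A_sets in \<open>auto simp: C_def\<close>)
    also have "\<dots> \<le> measure M (C n) + measure M (\<Union>i<n. sym_diff (B i) (V i))"
      by (rule measure_Un_le) (use B C V A_sets in auto)
    also have "measure M (\<Union>i<n. sym_diff (B i) (V i)) \<le> (\<Sum>i<n. measure M (sym_diff (B i) (V i)))"
      by (rule finite_measure_subadditive_finite) (use B V A_sets in auto)
    also have "\<dots> \<le> real n * d"
      using sum_bounded_above[of "{..<n}" "\<lambda>i. measure M (sym_diff (B i) (V i))" d] V(2)
      by (simp add: less_imp_le)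
    also have "real n * d \<le> e / 2"
      using \<open>0 < e\<close> by (simp add: d_def field_simps)
    finally show ?case using n \<open>?U \<in> A\<close> by (intro bexI[of _ ?U]) auto
  qed
qed

lemma cylinder_approximation:
  assumes "prob_space Q" and sets_eq: "sets Q = sets (power_space \<Gamma> N)" and "E \<in> sets Q" and "0 < e"
  shows "\<exists>V. cylinder_event \<Gamma> N V \<and> measure Q (sym_diff E V) < e"
proof -
  interpret prob_space Q by fact
  have sp: "space Q = space (power_space \<Gamma> N)"
    using sets_eq by (rule sets_eq_imp_space_eq)
  have restr: "(\<lambda>f. restrict f J) \<in> measurable Q (power_space J N)" if "J \<subseteq> \<Gamma>" for J
    using measurable_restrict_subset[OF that] measurable_cong_sets[OF sets_eq refl] by blast
  \<comment> \<open>The finite-dimensional marginals of \<open>Q\<close> form a projective family.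
    The interpretation serves to make the algebra of cylinder sets available as
    \<open>F.generator\<close>, together with the fact that it generates the product
    sigma-algebra.\<close>
  interpret F: projective_family \<Gamma> "\<lambda>J. distr Q (power_space J N) (\<lambda>f. restrict f J)" "\<lambda>_. N"
  proof (rule projective_family.intro)
    fix J H assume "J \<subseteq> H" "finite H" "H \<subseteq> \<Gamma>"
    then show "distr Q (power_space J N) (\<lambda>f. restrict f J)
        = distr (distr Q (power_space H N) (\<lambda>f. restrict f H)) (power_space J N) (\<lambda>f. restrict f J)"
      by (subst distr_distr)
        (auto intro!: restr measurable_restrict_subset distr_cong simp: Int_absorb1)
  next
    fix J assume "finite J" "J \<subseteq> \<Gamma>"
    then show "prob_space (distr Q (power_space J N) (\<lambda>f. restrict f J))"
      by (intro prob_space_distr restr)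
  qed
  obtain V where V: "V \<in> F.generator" "measure Q (sym_diff E V) < e"
    using algebra_approximation[of F.generator E e] assms F.algebra_generator F.sets_PiM_generator
    by (metis sp)
  from V(1) have "cylinder_event \<Gamma> N V"
    by cases (auto simp: cylinder_event_def determined_by_def prod_emb_def space_PiM intro!: exI)
  with V(2) show ?thesis by blast
qed

lemma determined_by_sets:
  assumes "J \<subseteq> \<Gamma>" "determined_by \<Gamma> M J V"
  shows "V \<in> sets (power_space \<Gamma> M)"
proof -
  from assms(2) obtain V0 where "V0 \<in> sets (power_space J M)"
    "V = {a \<in> space (power_space \<Gamma> M). restrict a J \<in> V0}"
    unfolding determined_by_def by blast
  then show ?thesis
    using measurable_sets[OF measurable_restrict_subset[OF assms(1)]]
    by (auto simp: vimage_def Int_def conj_commute)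
qed

text \<open>Two index sets are allowed, since the map is needed both on the whole product over
  \<Gamma> and between products over smaller sets of coordinates.\<close>

lemma measurable_reindex:
  assumes "\<pi> \<in> I \<rightarrow> L"
  shows "reindex I \<pi> \<in> measurable (power_space L M) (power_space I M)"
  unfolding reindex_def
  by (intro measurable_restrict measurable_component_singleton) (use assms in auto)

text \<open>Coordinate \<open>k\<close> of the reindexed point is coordinate \<pi>(k) of the
  original one, so testing membership in \<open>V\<close> reads only coordinates in the image of
  \<open>J\<close>. The base \<open>?W0\<close> is accordingly the preimage of \<open>V0\<close>
  under reindexing from \<open>L\<close> to \<open>J\<close>.\<close>

lemma determined_by_reindex:
  assumes \<pi>: "\<pi> \<in> \<Gamma> \<rightarrow> \<Gamma>" and "J \<subseteq> \<Gamma>" and "L \<subseteq> \<Gamma>" and image: "\<pi> ` J \<subseteq> L"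
    and "determined_by \<Gamma> M J V"
  shows "determined_by \<Gamma> M L (reindex \<Gamma> \<pi> -` V \<inter> space (power_space \<Gamma> M))"
proof -
  from assms(5) obtain V0 where V0: "V0 \<in> sets (power_space J M)"
    and V: "V = {a \<in> space (power_space \<Gamma> M). restrict a J \<in> V0}"
    unfolding determined_by_def by blast
  let ?W0 = "reindex J \<pi> -` V0 \<inter> space (power_space L M)"
  have "?W0 \<in> sets (power_space L M)"
    using V0 image by (intro measurable_sets[OF measurable_reindex]) auto
  moreover have "reindex \<Gamma> \<pi> a \<in> V \<longleftrightarrow> restrict a L \<in> ?W0"
    if a: "a \<in> space (power_space \<Gamma> M)" for a
  proof -
    have "restrict a L \<in> space (power_space L M)"
      using a \<open>L \<subseteq> \<Gamma>\<close> by (auto simp: space_PiM PiE_iff)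
    moreover have "reindex \<Gamma> \<pi> a \<in> space (power_space \<Gamma> M)"
      using measurable_space[OF measurable_reindex[OF \<pi>] a] .
    moreover have "restrict (reindex \<Gamma> \<pi> a) J = reindex J \<pi> (restrict a L)"
      using \<open>J \<subseteq> \<Gamma>\<close> image by (auto simp: reindex_def fun_eq_iff)
    ultimately show ?thesis by (simp add: V)
  qed
  ultimately show ?thesis
    unfolding determined_by_def by (intro bexI[of _ ?W0]) auto
qed

text \<open>Turns the bound on the supremum into a bound for each \<open>W\<close>. For a
  real-valued \<open>SUP\<close> this rests on the boundedness of the defect.\<close>

lemma kolmogorov_mixingE:
  assumes "prob_space P" "kolmogorov_mixing P \<Gamma> M X" "cylinder_event \<Gamma> M V" "0 < e"
  obtains K where "finite K" "K \<subseteq> \<Gamma>"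
    "\<And>W. determined_by \<Gamma> M (\<Gamma> - K) W \<Longrightarrow> mixing_defect P (joint \<Gamma> X) V W < e"
proof -
  obtain K where K: "finite K" "K \<subseteq> \<Gamma>"
    "(SUP W\<in>{W. determined_by \<Gamma> M (\<Gamma> - K) W}. mixing_defect P (joint \<Gamma> X) V W) < e"
    using assms(2-4) unfolding kolmogorov_mixing_def by blast
  have "mixing_defect P (joint \<Gamma> X) V W < e" if "determined_by \<Gamma> M (\<Gamma> - K) W" for W
    using cSUP_upper[OF _ prob_space.bdd_above_mixing_defect[OF assms(1)]] that K(3)
    by (metis (mono_tags) le_less_trans mem_Collect_eq)
  with K show thesis by (intro that) auto
qed

lemma (in finite_measure) abs_measure_diff_le_sym_diff:
  assumes "A \<in> sets M" "B \<in> sets M"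
  shows "\<bar>measure M A - measure M B\<bar> \<le> measure M (sym_diff A B)"
proof -
  have *: "measure M C \<le> measure M D + measure M (sym_diff C D)"
    if "C \<in> sets M" "D \<in> sets M" for C D
  proof -
    have "measure M C \<le> measure M (D \<union> sym_diff C D)"
      by (rule finite_measure_mono) (use that in auto)
    also have "\<dots> \<le> measure M D + measure M (sym_diff C D)"
      by (rule measure_Un_le) (use that in auto)
    finally show ?thesis .
  qed
  show ?thesis using *[of A B] *[of B A] assms by (simp add: Un_commute abs_le_iff)
qed

text \<open>The constant is 2 + 1 + 2: the intersection of \<open>V\<close> and \<open>W\<close>
  misses \<open>E\<close> by less than \<open>2 * e\<close>, mixing costs \<open>e\<close>, and
  replacing both factors of the product by \<open>prob E\<close> costs less than
  \<open>2 * e\<close>.\<close>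

lemma (in prob_space) almost_self_independent:
  assumes events: "E \<in> events" "V \<in> events" "W \<in> events"
    and V: "prob (sym_diff E V) < e" and W: "prob (sym_diff E W) < e"
    and VW: "\<bar>prob (V \<inter> W) - prob V * prob W\<bar> < e"
  shows "\<bar>prob E - prob E * prob E\<bar> < 5 * e"
proof -
  have "prob (sym_diff E (V \<inter> W)) \<le> prob (sym_diff E V \<union> sym_diff E W)"
    by (rule finite_measure_mono) (use events in auto)
  also have "\<dots> \<le> prob (sym_diff E V) + prob (sym_diff E W)"
    by (rule measure_Un_le) (use events in auto)
  finally have 1: "\<bar>prob E - prob (V \<inter> W)\<bar> < 2 * e"
    using abs_measure_diff_le_sym_diff[of E "V \<inter> W"] events V W by auto
  have *: "\<bar>prob E - prob V\<bar> < e" "\<bar>prob E - prob W\<bar> < e"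
    using abs_measure_diff_le_sym_diff[of E] events V W by (meson le_less_trans)+
  \<comment> \<open>The factors are exchanged one at a time, and the factor left standing is at most
    1.\<close>
  have "prob V * prob W - prob E * prob E
      = (prob V - prob E) * prob W + (prob W - prob E) * prob E"
    by (simp add: algebra_simps)
  also have "\<bar>\<dots>\<bar> \<le> \<bar>prob V - prob E\<bar> * prob W + \<bar>prob W - prob E\<bar> * prob E"
    by (metis abs_mult abs_of_nonneg abs_triangle_ineq measure_nonneg)
  also have "\<dots> \<le> \<bar>prob V - prob E\<bar> * 1 + \<bar>prob W - prob E\<bar> * 1"
    by (intro add_mono mult_left_mono) auto
  finally have "\<bar>prob V * prob W - prob E * prob E\<bar> < 2 * e"
    using * by (simp add: abs_minus_commute)
  with 1 VW show ?thesis by (simp only: abs_less_iff) linarith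
qed

theorem theorem3:
  fixes P :: "'w measure" and \<Gamma> :: "'i set" and M :: "'a measure"
    and X :: "'i \<Rightarrow> 'w \<Rightarrow> 'a" and E :: "('i \<Rightarrow> 'a) set"
  assumes "prob_space P"
    and "countable \<Gamma>"
    and "\<And>k. k \<in> \<Gamma> \<Longrightarrow> X k \<in> measurable P M"
    and "kolmogorov_mixing P \<Gamma> M X"
    and "E \<in> sets (power_space \<Gamma> M)"
    and "\<And>J. finite J \<Longrightarrow> J \<subseteq> \<Gamma> \<Longrightarrow>
           \<exists>\<pi>. positional_symmetry \<Gamma> M E \<pi> \<and> \<pi> ` J \<inter> J = {} \<and>
               distr P (power_space \<Gamma> M) (joint \<Gamma> X) =
               distr P (power_space \<Gamma> M) (joint \<Gamma> (\<lambda>k. X (\<pi> k)))"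
  shows "\<P>(\<omega> in P. joint \<Gamma> X \<omega> \<in> E) \<in> {0, 1}"
proof -
  interpret P: prob_space P by fact
  let ?S = "power_space \<Gamma> M"
  have joint: "joint \<Gamma> X \<in> measurable P ?S"
    unfolding joint_def by (intro measurable_restrict assms(3))
  \<comment> \<open>The argument takes place under the law of the family on the product space, where
    reindexing acts.\<close>
  define \<mu> where "\<mu> = distr P ?S (joint \<Gamma> X)"
  interpret \<mu>: prob_space \<mu>
    unfolding \<mu>_def by (rule P.prob_space_distr[OF joint])
  have [simp]: "sets \<mu> = sets ?S" "space \<mu> = space ?S" by (simp_all add: \<mu>_def)
  have law: "\<P>(\<omega> in P. joint \<Gamma> X \<omega> \<in> A) = \<mu>.prob A" if "A \<in> sets ?S" for A
    using that by (simp add: \<mu>_def measure_distr[OF joint] vimage_def Int_def conj_commute)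
  have small: "\<bar>\<mu>.prob E - \<mu>.prob E * \<mu>.prob E\<bar> < 5 * e" if "0 < e" for e
  proof -
    obtain V where "cylinder_event \<Gamma> M V" and EV: "\<mu>.prob (sym_diff E V) < e"
      using cylinder_approximation[of \<mu> \<Gamma> M E e] \<mu>.prob_space_axioms assms(5) \<open>0 < e\<close> by auto
    then obtain J where J: "finite J" "J \<subseteq> \<Gamma>" "determined_by \<Gamma> M J V"
      unfolding cylinder_event_def by blast
    obtain K where K: "finite K" "K \<subseteq> \<Gamma>"
      and mix: "\<And>W. determined_by \<Gamma> M (\<Gamma> - K) W \<Longrightarrow> mixing_defect P (joint \<Gamma> X) V W < e"
      using kolmogorov_mixingE[OF assms(1,4) \<open>cylinder_event \<Gamma> M V\<close> \<open>0 < e\<close>] by blast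
    \<comment> \<open>Displacing the union of \<open>J\<close> and \<open>K\<close>, not just
      \<open>J\<close>, is what sends \<open>J\<close> outside \<open>K\<close>.\<close>
    obtain \<pi> where sym: "positional_symmetry \<Gamma> M E \<pi>"
      and disj: "\<pi> ` (J \<union> K) \<inter> (J \<union> K) = {}"
      and dist: "\<mu> = distr P ?S (joint \<Gamma> (\<lambda>k. X (\<pi> k)))"
      using assms(6)[of "J \<union> K"] J K unfolding \<mu>_def by blast
    have \<pi>: "\<pi> \<in> \<Gamma> \<rightarrow> \<Gamma>" using sym by (simp add: positional_symmetry_def)
    have r: "reindex \<Gamma> \<pi> \<in> measurable ?S ?S" by (rule measurable_reindex[OF \<pi>])
    \<comment> \<open>Reindexing the family is reindexing its sample points, so equality of the two
      distributions says that \<mu> is invariant under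
      \<open>reindex \<Gamma> \<pi>\<close>.\<close>
    have "joint \<Gamma> (\<lambda>k. X (\<pi> k)) = reindex \<Gamma> \<pi> \<circ> joint \<Gamma> X"
      using \<pi> by (auto simp: joint_def reindex_def fun_eq_iff)
    then have inv: "\<mu> = distr \<mu> ?S (reindex \<Gamma> \<pi>)"
      unfolding \<mu>_def distr_distr[OF r joint] using dist by (simp add: \<mu>_def)
    have shift: "\<mu>.prob (reindex \<Gamma> \<pi> -` A \<inter> space ?S) = \<mu>.prob A" if "A \<in> sets ?S" for A
    proof -
      have "reindex \<Gamma> \<pi> \<in> measurable \<mu> ?S" using r by (simp add: \<mu>_def)
      from measure_distr[OF this that] show ?thesis using inv by simp
    qed
    define W where "W = reindex \<Gamma> \<pi> -` V \<inter> space ?S"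
    have V: "V \<in> sets ?S" by (rule determined_by_sets[OF J(2,3)])
    have W: "W \<in> sets ?S" unfolding W_def by (rule measurable_sets[OF r V])
    have "\<pi> ` J \<subseteq> \<Gamma> - K" using \<pi> J(2) disj by blast
    then have "determined_by \<Gamma> M (\<Gamma> - K) W"
      unfolding W_def by (intro determined_by_reindex[OF \<pi> J(2) _ _ J(3)]) auto
    from mix[OF this] have VW: "\<bar>\<mu>.prob (V \<inter> W) - \<mu>.prob V * \<mu>.prob W\<bar> < e"
      using V W by (simp only: mixing_defect_def law sets.Int)
    \<comment> \<open>By the symmetry, \<open>E\<close> is its own preimage, and \<open>W\<close> is
      the preimage of \<open>V\<close>. Invariance of \<mu> thus carries the error for
      \<open>V\<close> over to \<open>W\<close>.\<close>
    have "sym_diff E W = reindex \<Gamma> \<pi> -` sym_diff E V \<inter> space ?S"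
      using sym sets.sets_into_space[OF assms(5)]
      unfolding W_def positional_symmetry_def by blast
    then have "\<mu>.prob (sym_diff E W) < e"
      using EV shift[of "sym_diff E V"] V assms(5) by simp
    then show ?thesis
      using \<mu>.almost_self_independent[OF _ _ _ EV _ VW] V W assms(5) by simp
  qed
  \<comment> \<open>With \<open>e\<close> a fifth of the absolute value of this difference, the
    bound \<open>small\<close> would make a nonzero value strictly smaller than itself.\<close>
  have "\<mu>.prob E - \<mu>.prob E * \<mu>.prob E = 0"
    using small[of "\<bar>\<mu>.prob E - \<mu>.prob E * \<mu>.prob E\<bar> / 5"] by (rule_tac ccontr) simp
  then have "\<mu>.prob E * (1 - \<mu>.prob E) = 0" by (simp add: algebra_simps)
  then show ?thesis using law[OF assms(5)] by auto
qed

end
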